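(* Let $r>3$ be an integer and $n$ a positive integer. If the graph of an $\{r,r+1\}$-leaper on a $(2r+1)\times n$ board has a Hamiltonian circuit, then $n\ge r^2+5r+2$ if $r$ is odd, and $n\ge r^2+6r+4$ if $r$ is even.
   Context: For positive integers $r,s$, the graph of an $\{r,s\}$-leaper on an $m\times n$ board has vertex set $\{(x,y): 0\le x<m,\ 0\le y<n\}$ (integers), with an edge between $(x,y)$ and $(x',y')$ whenever $(x'-x,y'-y)\in\{(\pm r,\pm s),(\pm s,\pm r)\}$. Here $m=2r+1$. A Hamiltonian circuit is a cycle passing through every vertex exactly once. *)

theory Defs
  imports "Graph_Theory.Graph_Theory"
begin

definition leaper_graph :: "nat \<Rightarrow> nat \<Rightarrow> nat \<Rightarrow> nat \<Rightarrow> (int \<times> int) pair_pre_digraph" where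
  "leaper_graph r s m n =
     (let V = {0..<int m} \<times> {0..<int n}
      in \<lparr> pverts = V,
           parcs = {((x, y), (x', y')) | x y x' y'.
             (x, y) \<in> V \<and> (x', y') \<in> V \<and>
             (x' - x, y' - y) \<in>
               {int r, - int r} \<times> {int s, - int s} \<union> {int s, - int s} \<times> {int r, - int r}} \<rparr>)"

(* Undirected graphs are symmetric digraphs here, so a single edge traversed back and forth
   satisfies cycle; the length bound excludes it. *)
definition (in pre_digraph) hamiltonian_circuit :: "'b awalk \<Rightarrow> bool" where
  "hamiltonian_circuit p \<longleftrightarrow>
     cycle p \<and> 3 \<le> length p \<and> set (awalk_verts (tail G (hd p)) p) = verts G"

definition (in pre_digraph) hamiltonian :: bool where
  "hamiltonian \<longleftrightarrow> (\<exists>p. hamiltonian_circuit p)"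

lemma pair_graph_leaper_graph:
  assumes "0 < r" "0 < s"
  shows "pair_graph (leaper_graph r s m n)"
proof -
  let ?G = "leaper_graph r s m n"
  have fin: "finite (pverts ?G)"
    by (simp add: leaper_graph_def Let_def)
  have sub: "parcs ?G \<subseteq> pverts ?G \<times> pverts ?G"
    unfolding leaper_graph_def Let_def by force
  have fina: "finite (parcs ?G)"
    using finite_subset[OF sub] fin by simp
  have loop: "fst e \<noteq> snd e" if "e \<in> parcs ?G" for e
    using that assms unfolding leaper_graph_def Let_def by force
  have arc_iff: "((x, y), (x', y')) \<in> parcs ?G \<longleftrightarrow>
      (x, y) \<in> pverts ?G \<and> (x', y') \<in> pverts ?G \<and>
      (x' - x, y' - y) \<in> {int r, - int r} \<times> {int s, - int s} \<union> {int s, - int s} \<times> {int r, - int r}"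
    for x y x' y'
    by (simp add: leaper_graph_def Let_def)
  have neg: "a - b \<in> {int k, - int k} \<longleftrightarrow> b - a \<in> {int k, - int k}" for a b k
    by (simp, linarith)
  have symm: "sym (parcs ?G)"
  proof (rule symI)
    fix u v
    assume uv: "(u, v) \<in> parcs ?G"
    obtain x y x' y' where eq: "u = (x, y)" "v = (x', y')"
      by (cases u, cases v)
    show "(v, u) \<in> parcs ?G"
      using uv neg[of x' x r] neg[of x' x s] neg[of y' y r] neg[of y' y s]
      unfolding eq arc_iff Un_iff mem_Sigma_iff by blast
  qed
  show ?thesis
  proof (unfold_locales, goal_cases)
    case (1 e) then show ?case using sub by force
  next
    case (2 e) then show ?case using sub by force
  next
    case 3 then show ?case by (rule fin)
  next
    case 4 then show ?case by (rule fina)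
  next
    case (5 e) then show ?case by (rule loop)
  next
    case 6 then show ?case using symm by (simp add: symmetric_def)
  qed
qed

end

theory Submission
  imports Defs
begin

text \<open>
  Write \<open>s = r + 1\<close> and let \<open>p y\<close>, \<open>q y\<close> be the numbers of edges of the circuit that join file \<open>y\<close> to the files
  \<open>y + s\<close> and \<open>y + r\<close>.  An edge that shifts the file by \<open>s\<close> shifts the rank by \<open>r\<close> and vice versa, hence
  \<open>p y \<le> 2 * s\<close> and \<open>q y \<le> 2 * r\<close>, while each file has degree sum \<open>2 * (2 * r + 1) = 2 * s + 2 * r\<close>.  For even \<open>n\<close>
  below the bound, all boards but two admit no such pair \<open>p\<close>, \<open>q\<close>.

  Indeed the bottom \<open>r\<close> files must use all their upward edges, which saturates a block of files above them, and so
  on in shrinking alternating blocks; the blocks counted from the top and from the bottom clash unless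
  \<open>2 * k * r \<le> n \<le> 2 * k * s\<close> for some \<open>k\<close>.  For these \<open>n\<close>, weight the degree equations by an alternating square
  wave of half-period \<open>s\<close> (or \<open>r\<close>).  All terms \<open>p y\<close> (or \<open>q y\<close>) cancel, and the other ones survive only
  next to every second jump of the wave; comparing with the capacities excludes the lower half of the interval
  (or the upper half).  Colouring the board like a chessboard shows that \<open>n\<close> is even.  Eighteen boards with
  \<open>r \<le> 12\<close> need separate dual certificates.  For the \<open>9 \<times> 38\<close> and \<open>9 \<times> 40\<close> boards, where 2-factors do exist, these
  also use that a Hamiltonian circuit contains no shorter cycle.
\<close>

section \<open>Hamiltonian circuits as edge sets\<close>

lemma cycle_successor:
  assumes "pre_digraph.hamiltonian_circuit (with_proj G) p"
  defines "L \<equiv> length p" and "vs \<equiv> map fst p"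
  shows "3 \<le> L" "distinct vs" "length vs = L" "set vs = pverts G"
    and "i < L \<Longrightarrow> (vs ! i, vs ! (Suc i mod L)) \<in> parcs G"
proof -
  let ?G = "with_proj G"
  let ?av = "pre_digraph.awalk_verts ?G"
  have cyc: "pre_digraph.cycle ?G p" and len: "3 \<le> length p"
    and verts: "set (?av (fst (hd p)) p) = pverts G"
    using assms(1) by (simp_all add: pre_digraph.hamiltonian_circuit_def)
  from cyc obtain u where u: "pre_digraph.awalk ?G u p u" "distinct (tl (?av u p))" "p \<noteq> []"
    by (auto simp: pre_digraph.cycle_def)
  then have arcs: "set p \<subseteq> parcs G" and cas: "pre_digraph.cas ?G u p u"
    by (auto simp: pre_digraph.awalk_def)
  have eq1: "?av u p = map fst p @ [snd (last p)]"
    using pre_digraph.awalk_verts_conv[of ?G u p] u(3) by simp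
  have eq2: "?av u p = u # map snd p"
    using pre_digraph.awalk_verts_conv'[OF cas] u(3) cas by (cases p) (auto simp: pre_digraph.cas.simps)
  have dist: "distinct (map snd p)" using u(2) eq2 by simp
  have u0: "u = fst (hd p)" using cas u(3) by (cases p) (auto simp: pre_digraph.cas.simps)
  have "v = snd (last q)" if "pre_digraph.cas ?G a q v" "q \<noteq> []" for a q v
    using that by (induction q arbitrary: a) (auto simp: pre_digraph.cas.simps split: if_splits)
  then have ul: "u = snd (last p)" using cas u(3) by blast
  \<comment> \<open>Read by tails or by heads, the closed walk gives the same vertices; only the
    place of the base point \<open>u\<close> differs. Hence distinctness passes from the heads to
    the tails.\<close>
  have rot: "vs @ [u] = u # map snd p" using eq1 eq2 ul by (simp add: vs_def)
  have "mset vs = mset (map snd p)"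
    using arg_cong[OF rot, of mset] by simp
  then show "distinct vs" using dist by (metis mset_eq_imp_distinct_iff)
  show "3 \<le> L" "length vs = L" using len by (simp_all add: L_def vs_def)
  have "set (map fst p) = set (map snd p)"
    using \<open>mset vs = mset (map snd p)\<close> by (metis set_mset_mset vs_def)
  moreover have "set (?av (fst (hd p)) p) = insert u (set (map snd p))"
    using eq2 u0 by simp
  moreover have "u \<in> set (map snd p)" using ul u(3) by simp
  ultimately show "set vs = pverts G" using verts by (auto simp: vs_def)
  assume i: "i < L"
  have "p ! i = (vs ! i, vs ! (Suc i mod L))"
  proof (rule prod_eqI)
    show "fst (p ! i) = fst (vs ! i, vs ! (Suc i mod L))" using i by (simp add: vs_def L_def)
    have "snd (p ! i) = (vs @ [u]) ! Suc i" using i rot by (simp add: L_def)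
    also have "\<dots> = vs ! (Suc i mod L)"
    proof (cases "Suc i = L")
      case True
      then have "vs ! 0 = u" using u0 u(3) by (simp add: vs_def hd_conv_nth)
      then show ?thesis using True by (simp add: nth_append vs_def L_def)
    next
      case False
      then have "Suc i < L" using i by simp
      then show ?thesis by (simp add: nth_append vs_def L_def)
    qed
    finally show "snd (p ! i) = snd (vs ! i, vs ! (Suc i mod L))" by simp
  qed
  then show "(vs ! i, vs ! (Suc i mod L)) \<in> parcs G"
    using arcs i by (metis L_def nth_mem subsetD)
qed

lemma bij_betw_Suc_mod: "bij_betw (\<lambda>i. Suc i mod L) {..<L} {..<L}" for L :: nat
proof (rule bij_betw_imageI)
  show "inj_on (\<lambda>i. Suc i mod L) {..<L}"
    by (rule inj_onI) (auto simp: mod_Suc split: if_splits)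
  then show "(\<lambda>i. Suc i mod L) ` {..<L} = {..<L}"
    by (intro endo_inj_surj) (auto intro: mod_less_divisor)
qed

text \<open>Each edge is directed towards the larger \<open>h\<close>, so an undirected edge yields
  one pair. The last two facts hold the structure of a circuit: degree 2 everywhere, tested against
  arbitrary weights, and connectedness.\<close>

lemma oriented_cycle_edges:
  fixes vs :: "'a list" and h :: "'a \<Rightarrow> int"
  assumes L: "3 \<le> L" "length vs = L" and dist: "distinct vs"
    and h: "\<And>i. i < L \<Longrightarrow> h (vs ! i) \<noteq> h (vs ! (Suc i mod L))"
  defines "nx \<equiv> \<lambda>i. Suc i mod L"
  defines "E \<equiv> (\<lambda>i. if h (vs ! i) < h (vs ! nx i) then (vs ! i, vs ! nx i) else (vs ! nx i, vs ! i)) ` {..<L}"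
  shows "finite E" "\<And>u w. (u, w) \<in> E \<Longrightarrow> h u < h w"
    and "\<And>u w. (u, w) \<in> E \<Longrightarrow> \<exists>i<L. {u, w} = {vs ! i, vs ! nx i}"
    and "\<And>l :: 'a \<Rightarrow> int. (\<Sum>(u, w)\<in>E. l u + l w) = 2 * (\<Sum>v\<in>set vs. l v)"
    and "\<And>C. C \<subseteq> set vs \<Longrightarrow> C \<noteq> {} \<Longrightarrow> C \<noteq> set vs \<Longrightarrow> \<exists>(u, w)\<in>E. (u \<in> C) \<noteq> (w \<in> C)"
proof -
  let ?f = "\<lambda>i. if h (vs ! i) < h (vs ! nx i) then (vs ! i, vs ! nx i) else (vs ! nx i, vs ! i)"
  have nx: "nx i < L" for i using L by (simp add: nx_def)
  show "finite E" by (simp add: E_def)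
  show "h u < h w" if "(u, w) \<in> E" for u w
    using that h by (fastforce simp: E_def nx_def split: if_splits)
  show "\<exists>i<L. {u, w} = {vs ! i, vs ! nx i}" if "(u, w) \<in> E" for u w
    using that by (auto simp: E_def split: if_splits)
  have vs_eq: "vs ! i = vs ! j \<longleftrightarrow> i = j" if "i < L" "j < L" for i j
    using that L dist by (simp add: nth_eq_iff_index_eq)
  have inj: "inj_on ?f {..<L}"
  proof (rule inj_onI)
    fix i j assume ij: "i \<in> {..<L}" "j \<in> {..<L}" "?f i = ?f j"
    then have "i = j \<or> (i = nx j \<and> j = nx i)"
      using nx by (auto simp: vs_eq split: if_splits)
    \<comment> \<open>Positions that are each other's successor would force length at most 2, which
      \<open>3 \<le> L\<close> excludes.\<close>
    then show "i = j" using L ij(1,2) by (auto simp: nx_def mod_Suc split: if_splits)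
  qed
  show "(\<Sum>(u, w)\<in>E. l u + l w) = 2 * (\<Sum>v\<in>set vs. l v)" for l :: "'a \<Rightarrow> int"
  proof -
    have "(\<Sum>(u, w)\<in>E. l u + l w) = (\<Sum>i<L. l (vs ! i) + l (vs ! nx i))"
      unfolding E_def by (subst sum.reindex[OF inj]) (rule sum.cong, auto)
    also have "\<dots> = (\<Sum>i<L. l (vs ! i)) + (\<Sum>i<L. l (vs ! nx i))"
      by (rule sum.distrib)
    also have "(\<Sum>i<L. l (vs ! nx i)) = (\<Sum>i<L. l (vs ! i))"
      unfolding nx_def by (rule sum.reindex_bij_betw[OF bij_betw_Suc_mod])
    also have "(\<Sum>i<L. l (vs ! i)) = (\<Sum>v\<in>set vs. l v)"
      by (rule sum.reindex_bij_betw) (use bij_betw_nth[OF dist] L in auto)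
    finally show ?thesis by simp
  qed
  show "\<exists>(u, w)\<in>E. (u \<in> C) \<noteq> (w \<in> C)" if C: "C \<subseteq> set vs" "C \<noteq> {}" "C \<noteq> set vs" for C
  proof (rule ccontr)
    assume no: "\<not> (\<exists>(u, w)\<in>E. (u \<in> C) \<noteq> (w \<in> C))"
    have step: "vs ! i \<in> C \<longleftrightarrow> vs ! nx i \<in> C" if "i < L" for i
    proof -
      have "?f i \<in> E" using that by (simp add: E_def)
      then show ?thesis using no by (auto split: if_splits)
    qed
    have all: "vs ! i \<in> C \<longleftrightarrow> vs ! 0 \<in> C" if "i < L" for i
      using that
    proof (induction i)
      case (Suc i)
      then show ?case using step[of i] by (simp add: nx_def)
    qed simp
    have "C = {} \<or> set vs \<subseteq> C"
      using all C(1) L(2) by (metis equals0I in_set_conv_nth subsetD subsetI)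
    with C show False by blast
  qed
qed

section \<open>Leaper circuits on the board\<close>

definition board :: "nat \<Rightarrow> nat \<Rightarrow> (int \<times> int) set" where
  "board r n = {0..2 * int r} \<times> {0..<int n}"

lemma card_board: "card (board r n) = (2 * r + 1) * n"
  by (simp add: board_def nat_add_distrib nat_mult_distrib)

text \<open>With the indicator of a vertex for \<open>l\<close>, \<open>weight\<close> becomes the
  degree condition; \<open>cut\<close> is connectedness. Pairs point to the larger file, so no edge
  is listed in both directions.\<close>

locale leaper_cycle =
  fixes r n :: nat and E :: "((int \<times> int) \<times> (int \<times> int)) set"
  assumes r_pos: "0 < r"
    and finite_E: "finite E"
    and edgeD: "\<And>x y x' y'. ((x, y), (x', y')) \<in> E \<Longrightarrow>
      (x, y) \<in> board r n \<and> (x', y') \<in> board r n \<and>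
      (y' = y + int r + 1 \<and> \<bar>x' - x\<bar> = int r \<or> y' = y + int r \<and> \<bar>x' - x\<bar> = int r + 1)"
    and weight: "\<And>l :: int \<times> int \<Rightarrow> int. (\<Sum>(u, w)\<in>E. l u + l w) = 2 * (\<Sum>v\<in>board r n. l v)"
    and cut: "\<And>C. C \<subseteq> board r n \<Longrightarrow> C \<noteq> {} \<Longrightarrow> C \<noteq> board r n \<Longrightarrow>
      \<exists>(u, w)\<in>E. (u \<in> C) \<noteq> (w \<in> C)"

lemma hamiltonian_imp_leaper_cycle:
  assumes "0 < r" and "pre_digraph.hamiltonian (with_proj (leaper_graph r (r + 1) (2 * r + 1) n))"
  obtains E where "leaper_cycle r n E"
proof -
  let ?G = "leaper_graph r (r + 1) (2 * r + 1) n"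
  have V: "pverts ?G = board r n"
    by (auto simp: leaper_graph_def board_def Let_def)
  have arc: "u \<in> board r n \<and> v \<in> board r n \<and>
      (\<bar>snd v - snd u\<bar> = int r + 1 \<and> \<bar>fst v - fst u\<bar> = int r \<or>
       \<bar>snd v - snd u\<bar> = int r \<and> \<bar>fst v - fst u\<bar> = int r + 1)"
    if "(u, v) \<in> parcs ?G" for u v
    using that unfolding V[symmetric] by (auto simp: leaper_graph_def Let_def)
  obtain p where p: "pre_digraph.hamiltonian_circuit (with_proj ?G) p"
    using assms(2) by (auto simp: pre_digraph.hamiltonian_def)
  note cs = cycle_successor[OF p]
  define L where "L = length p"
  define vs where "vs = map fst p"
  have step: "(vs ! i, vs ! (Suc i mod L)) \<in> parcs ?G" if "i < L" for i
    using cs(5) that by (simp add: vs_def L_def)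
  have ne: "snd (vs ! i) \<noteq> snd (vs ! (Suc i mod L))" if "i < L" for i
    using arc[OF step[OF that]] assms(1) by auto
  define E where "E = (\<lambda>i. if snd (vs ! i) < snd (vs ! (Suc i mod L))
    then (vs ! i, vs ! (Suc i mod L)) else (vs ! (Suc i mod L), vs ! i)) ` {..<L}"
  have L3: "3 \<le> L" and len: "length vs = L" and dist: "distinct vs" and set: "set vs = board r n"
    using cs V by (simp_all add: vs_def L_def)
  note ce = oriented_cycle_edges[where h = snd, OF L3 len dist ne, folded E_def]
  have "leaper_cycle r n E"
  proof
    show "0 < r" by (fact assms(1))
    show "finite E" by (simp add: E_def)
    show "(\<Sum>(u, w)\<in>E. l u + l w) = 2 * (\<Sum>v\<in>board r n. l v)" for l :: "int \<times> int \<Rightarrow> int"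
      using ce(4) set by simp
    show "\<exists>(u, w)\<in>E. (u \<in> C) \<noteq> (w \<in> C)"
      if "C \<subseteq> board r n" "C \<noteq> {}" "C \<noteq> board r n" for C
      using ce(5) set that by simp
    show "(x, y) \<in> board r n \<and> (x', y') \<in> board r n \<and>
      (y' = y + int r + 1 \<and> \<bar>x' - x\<bar> = int r \<or> y' = y + int r \<and> \<bar>x' - x\<bar> = int r + 1)"
      if e: "((x, y), (x', y')) \<in> E" for x y x' y'
    proof -
      have lt: "y < y'" using ce(2)[OF _ e] by simp
      obtain i where i: "i < L" "{(x, y), (x', y')} = {vs ! i, vs ! (Suc i mod L)}"
        using ce(3)[OF _ e] by auto
      then consider "vs ! i = (x, y)" "vs ! (Suc i mod L) = (x', y')"
        | "vs ! i = (x', y')" "vs ! (Suc i mod L) = (x, y)"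
        by (auto simp: doubleton_eq_iff)
      then show ?thesis
        using lt arc[OF step[OF i(1)]] by cases (auto simp: abs_if split: if_splits)
    qed
  qed
  then show ?thesis by (rule that)
qed

context leaper_cycle begin

text \<open>Subtour elimination: the degree sum \<open>2 * card C\<close> counts inner edges twice
  and leaving edges once, and connectedness provides a leaving edge.\<close>

lemma cycle_edges_inside:
  assumes "C \<subseteq> board r n" "C \<noteq> {}" "C \<noteq> board r n"
  shows "(\<Sum>(u, w)\<in>E. of_bool (u \<in> C \<and> w \<in> C)) \<le> int (card C) - 1"
proof -
  let ?i = "\<lambda>(u, w). of_bool (u \<in> C \<and> w \<in> C) :: int"
  let ?x = "\<lambda>(u, w). of_bool ((u \<in> C) \<noteq> (w \<in> C)) :: int"
  have fin: "finite (board r n)" by (simp add: board_def)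
  obtain e where e: "e \<in> E" "?x e = 1"
    using cut[OF assms] by fastforce
  have "1 \<le> (\<Sum>e\<in>E. ?x e)"
    using member_le_sum[OF e(1), of ?x] finite_E e(2) by (auto split: prod.splits)
  moreover have "2 * (\<Sum>e\<in>E. ?i e) + (\<Sum>e\<in>E. ?x e) = (\<Sum>(u, w)\<in>E. of_bool (u \<in> C) + of_bool (w \<in> C))"
    unfolding sum_distrib_left sum.distrib[symmetric] by (rule sum.cong) auto
  moreover have "\<dots> = 2 * int (card C)"
  proof -
    have "(\<Sum>v\<in>board r n. of_bool (v \<in> C)) = int (card C)"
      using assms(1) fin by (simp add: sum.If_cases of_bool_def Int_absorb1)
    then show ?thesis using weight[of "\<lambda>v. of_bool (v \<in> C)"] by simp
  qed
  ultimately have "2 * (\<Sum>e\<in>E. ?i e) + 1 \<le> 2 * int (card C)" by linarith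
  then show ?thesis by linarith
qed

text \<open>Every edge changes \<open>x + y\<close> by an odd amount, so the weight
  \<open>(-1)^(x + y)\<close> cancels over its two ends; on an odd by odd board the total weight is
  1.\<close>

lemma even_n: "even n"
proof (rule ccontr)
  assume odd: "odd n"
  define g :: "int \<Rightarrow> int" where "g y = (if even y then 1 else -1)" for y
  have "(\<Sum>y\<in>{0..<int m}. g y) = of_bool (odd m)" for m
  proof (induction m)
    case (Suc m)
    have "{0..<int (Suc m)} = insert (int m) {0..<int m}" by auto
    then show ?case using Suc by (simp add: g_def)
  qed simp
  from this[of n] this[of "2 * r + 1"]
  have "(\<Sum>y\<in>{0..<int n}. g y) = 1" "(\<Sum>x\<in>{0..2 * int r}. g x) = 1"
    using odd by (simp_all add: atLeastLessThanPlusOne_atLeastAtMost_int add.commute[of 1] mult.commute[of _ 2])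
  moreover have "(\<Sum>v\<in>board r n. g (fst v) * g (snd v)) = (\<Sum>x\<in>{0..2 * int r}. g x) * (\<Sum>y\<in>{0..<int n}. g y)"
    by (simp add: board_def sum_product sum.cartesian_product case_prod_beta')
  ultimately have "(\<Sum>v\<in>board r n. g (fst v) * g (snd v)) = 1" by simp
  moreover have "(\<Sum>(u, w)\<in>E. g (fst u) * g (snd u) + g (fst w) * g (snd w)) = 0"
  proof (rule sum.neutral, clarify)
    fix x y x' y' assume "((x, y), x', y') \<in> E"
    from edgeD[OF this] have "y' = y + int r + 1 \<and> (x' = x + int r \<or> x = x' + int r) \<or>
        y' = y + int r \<and> (x' = x + (int r + 1) \<or> x = x' + (int r + 1))"
      by (auto simp: abs_if split: if_splits)
    then have "even (x + y) \<noteq> even (x' + y')" by presburger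
    then show "g (fst (x, y)) * g (snd (x, y)) + g (fst (x', y')) * g (snd (x', y')) = 0"
      by (auto simp: g_def)
  qed
  ultimately show False using weight[of "\<lambda>v. g (fst v) * g (snd v)"] by simp
qed

end

section \<open>Flows between files\<close>

locale file_flow =
  fixes r n :: int and p q :: "int \<Rightarrow> int"
  assumes r_pos: "0 < r"
    and p_nonneg: "0 \<le> p y" and p_le: "p y \<le> 2 * (r + 1)"
    and q_nonneg: "0 \<le> q y" and q_le: "q y \<le> 2 * r"
    and p_outside: "y < 0 \<or> n \<le> y + (r + 1) \<Longrightarrow> p y = 0"
    and q_outside: "y < 0 \<or> n \<le> y + r \<Longrightarrow> q y = 0"
    and balance: "0 \<le> y \<Longrightarrow> y < n \<Longrightarrow> p y + p (y - (r + 1)) + (q y + q (y - r)) = 2 * (2 * r + 1)"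
begin

lemma sum_shift_outside:
  fixes f :: "int \<Rightarrow> int"
  assumes "\<And>y. y < 0 \<or> n \<le> y + d \<Longrightarrow> f y = 0" "0 \<le> d"
  shows "(\<Sum>y\<in>{0..<n}. l y * f (y - d)) = (\<Sum>y\<in>{0..<n}. f y * l (y + d))"
proof -
  have "(\<Sum>y\<in>{0..<n}. l y * f (y - d)) = (\<Sum>y\<in>{d..<n}. l y * f (y - d))"
    by (rule sum.mono_neutral_right) (use assms in auto)
  also have "\<dots> = (\<Sum>y\<in>{0..<n - d}. f y * l (y + d))"
    by (rule sum.reindex_bij_witness[where i = "\<lambda>y. y + d" and j = "\<lambda>y. y - d"]) auto
  also have "\<dots> = (\<Sum>y\<in>{0..<n}. f y * l (y + d))"
    by (rule sum.mono_neutral_left) (use assms in auto)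
  finally show ?thesis .
qed

text \<open>Summation by parts moves the shifts from the flows to the weight. By the capacities of
  \<open>p\<close> and \<open>q\<close>, every \<open>l\<close> then gives a necessary condition, as
  in linear programming duality.\<close>

lemma weighted_balance:
  "2 * (2 * r + 1) * (\<Sum>y\<in>{0..<n}. l y) =
    (\<Sum>y\<in>{0..<n}. p y * (l y + l (y + (r + 1)))) + (\<Sum>y\<in>{0..<n}. q y * (l y + l (y + r)))"
proof -
  have "2 * (2 * r + 1) * (\<Sum>y\<in>{0..<n}. l y) =
      (\<Sum>y\<in>{0..<n}. l y * (p y + p (y - (r + 1)) + (q y + q (y - r))))"
    unfolding sum_distrib_left by (rule sum.cong) (auto simp: balance)
  also have "\<dots> = (\<Sum>y\<in>{0..<n}. p y * l y) + (\<Sum>y\<in>{0..<n}. l y * p (y - (r + 1))) +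
      ((\<Sum>y\<in>{0..<n}. q y * l y) + (\<Sum>y\<in>{0..<n}. l y * q (y - r)))"
    by (simp add: algebra_simps sum.distrib)
  also have "(\<Sum>y\<in>{0..<n}. l y * p (y - (r + 1))) = (\<Sum>y\<in>{0..<n}. p y * l (y + (r + 1)))"
    by (rule sum_shift_outside) (use p_outside r_pos in auto)
  also have "(\<Sum>y\<in>{0..<n}. l y * q (y - r)) = (\<Sum>y\<in>{0..<n}. q y * l (y + r))"
    by (rule sum_shift_outside) (use q_outside r_pos in auto)
  finally show ?thesis by (simp add: sum.distrib algebra_simps)
qed

text \<open>Turning the board upside down makes the upper end of an edge its lower end, hence the
  extra shift by \<open>r + 1\<close> or \<open>r\<close>.\<close>

lemma reflected: "file_flow r n (\<lambda>y. p (n - 1 - (r + 1) - y)) (\<lambda>y. q (n - 1 - r - y))"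
proof
  fix y :: int
  assume "0 \<le> y" "y < n"
  then show "p (n - 1 - (r + 1) - y) + p (n - 1 - (r + 1) - (y - (r + 1))) +
      (q (n - 1 - r - y) + q (n - 1 - r - (y - r))) = 2 * (2 * r + 1)"
    using balance[of "n - 1 - y"] by (simp add: algebra_simps)
qed (use r_pos p_nonneg p_le q_nonneg q_le in \<open>auto intro!: p_outside q_outside\<close>)

text \<open>The two capacities add up to the full degree sum of a file. Both lower neighbours of a
  file in block \<open>k + 1\<close> lie in block \<open>k\<close>: if that block is saturated,
  nothing is left to go up; if it is empty, everything must go up.\<close>

lemma bottom_block:
  assumes "int k * (r + 1) \<le> y" "y < (int k + 1) * r" "y < n"
  shows "if even k then p y = 2 * (r + 1) \<and> q y = 2 * r else p y = 0 \<and> q y = 0"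
  using assms
proof (induction k arbitrary: y)
  case 0
  then have "p y + q y = 2 * (2 * r + 1)"
    using balance[of y] by (simp add: p_outside q_outside)
  then show ?case using p_le[of y] q_le[of y] by simp
next
  case (Suc k)
  have "int k * (r + 1) \<le> y - (r + 1)" "y - (r + 1) < (int k + 1) * r"
       "int k * (r + 1) \<le> y - r" "y - r < (int k + 1) * r"
    using Suc.prems r_pos by (auto simp: algebra_simps)
  then have *: "if even k then p (y - (r + 1)) = 2 * (r + 1) \<and> q (y - r) = 2 * r
      else p (y - (r + 1)) = 0 \<and> q (y - r) = 0"
    using Suc.IH[of "y - (r + 1)"] Suc.IH[of "y - r"] Suc.prems(3) r_pos
    by (auto split: if_splits)
  have "0 \<le> int (Suc k) * (r + 1)" using r_pos by simp
  then have "p y + p (y - (r + 1)) + (q y + q (y - r)) = 2 * (2 * r + 1)"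
    using Suc.prems(1,3) by (intro balance) linarith+
  with * show ?case
    using p_le[of y] q_le[of y] p_nonneg[of y] q_nonneg[of y] by (auto split: if_splits)
qed

text \<open>The middle file lies in block \<open>m\<close> counted from either side. Its degree sum
  would be twice the required value for even \<open>m\<close> and zero for odd
  \<open>m\<close>.\<close>

lemma no_flow_block:
  assumes "0 \<le> m" "2 * m * (r + 1) < n" "n < 2 * (m + 1) * r"
  shows False
proof -
  define y where "y = (n - 1) div 2"
  have y: "m * (r + 1) \<le> y" "y < (m + 1) * r" "m * (r + 1) \<le> n - 1 - y" "n - 1 - y < (m + 1) * r"
    using assms(2,3) unfolding y_def by (auto simp: algebra_simps)
  have "0 \<le> m * (r + 1)" using assms(1) r_pos by simp
  then have yn: "0 \<le> y" "y < n" using y by linarith+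
  interpret refl: file_flow r n "\<lambda>y. p (n - 1 - (r + 1) - y)" "\<lambda>y. q (n - 1 - r - y)"
    by (rule reflected)
  have idx: "n - 1 - (r + 1) - (n - 1 - y) = y - (r + 1)" "n - 1 - r - (n - 1 - y) = y - r"
    by simp_all
  show False
    using bottom_block[of "nat m" y] refl.bottom_block[of "nat m" "n - 1 - y"]
      balance[OF yn] y yn assms(1) r_pos unfolding idx by (auto split: if_splits)
qed

end

section \<open>Square waves\<close>

definition square_wave :: "int \<Rightarrow> int \<Rightarrow> int" where
  "square_wave s y = (if y mod (2 * s) < s then 1 else -1)"

lemma mod_eqI_int: "a = M * k + b \<Longrightarrow> 0 \<le> b \<Longrightarrow> b < M \<Longrightarrow> a mod M = b" for a b M k :: int
  by simp

lemma square_wave_plus_period: "0 < s \<Longrightarrow> square_wave s (y + s) = - square_wave s y"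
proof -
  assume s: "0 < s"
  define w where "w = y mod (2 * s)"
  have w: "0 \<le> w" "w < 2 * s" using s by (simp_all add: w_def)
  have "(y + s) mod (2 * s) = (w + s) mod (2 * s)" by (simp add: w_def mod_add_left_eq)
  also have "\<dots> = (if w < s then w + s else w - s)"
    using w s by (auto intro: mod_eqI_int[of _ _ 0] mod_eqI_int[of _ _ 1])
  finally show ?thesis using w s by (auto simp: square_wave_def w_def[symmetric])
qed

text \<open>A shift by one half-period changes the sign, so a shift that is off by one leaves the
  difference of neighbouring values. It is 2 at jumps of one direction, -2 at those of the other,
  and 0 elsewhere.\<close>

lemma square_wave_overlap:
  assumes "0 < r"
  shows "square_wave (r + 1) y + square_wave (r + 1) (y + r) \<le> 2 * of_bool (2 * (r + 1) dvd y)"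
    and "square_wave r y + square_wave r (y + (r + 1)) \<le> 2 * of_bool (2 * r dvd y + (r + 1))"
proof -
  define w where "w = y mod (2 * (r + 1))"
  have w: "0 \<le> w" "w < 2 * (r + 1)" using assms by (simp_all add: w_def)
  have "(y + r) mod (2 * (r + 1)) = (w + r) mod (2 * (r + 1))" by (simp add: w_def mod_add_left_eq)
  also have "\<dots> = (if w < r + 2 then w + r else w - r - 2)"
    using w assms by (auto intro: mod_eqI_int[of _ _ 0] mod_eqI_int[of _ _ 1])
  finally have *: "(y + r) mod (2 * (r + 1)) = (if w < r + 2 then w + r else w - r - 2)" .
  show "square_wave (r + 1) y + square_wave (r + 1) (y + r) \<le> 2 * of_bool (2 * (r + 1) dvd y)"
    unfolding square_wave_def dvd_eq_mod_eq_0 * w_def[symmetric] using w assms by auto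
next
  define w where "w = y mod (2 * r)"
  have w: "0 \<le> w" "w < 2 * r" using assms by (simp_all add: w_def)
  have "(y + (r + 1)) mod (2 * r) = (w + (r + 1)) mod (2 * r)" by (metis w_def mod_add_left_eq)
  also have "\<dots> = (if w < r - 1 then w + r + 1 else w - r + 1)"
    using w assms by (auto intro: mod_eqI_int[of _ _ 0] mod_eqI_int[of _ _ 1])
  finally show "square_wave r y + square_wave r (y + (r + 1)) \<le> 2 * of_bool (2 * r dvd y + (r + 1))"
    using w assms by (auto simp: square_wave_def w_def[symmetric] dvd_eq_mod_eq_0)
qed

text \<open>Full periods cancel, so the partial sums form a periodic tent with peak
  \<open>s\<close>.\<close>

lemma sum_square_wave_nat:
  assumes "0 < s"
  shows "(\<Sum>y\<in>{0..<int m}. square_wave s y) = min (int m mod (2 * s)) (2 * s - int m mod (2 * s))"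
proof (induction m)
  case (Suc m)
  define w where "w = int m mod (2 * s)"
  have w: "0 \<le> w" "w < 2 * s" using assms by (simp_all add: w_def)
  have "int (Suc m) mod (2 * s) = (w + 1) mod (2 * s)" by (metis w_def mod_add_left_eq of_nat_Suc add.commute)
  also have "\<dots> = (if w = 2 * s - 1 then 0 else w + 1)"
    using w by (auto intro: mod_eqI_int[of _ _ 0])
  finally have *: "int (Suc m) mod (2 * s) = (if w = 2 * s - 1 then 0 else w + 1)" .
  have "{0..<int (Suc m)} = insert (int m) {0..<int m}" by auto
  then have "(\<Sum>y\<in>{0..<int (Suc m)}. square_wave s y) = square_wave s (int m) + min w (2 * s - w)"
    using Suc by (simp add: w_def)
  then show ?case using w assms unfolding * by (auto simp: square_wave_def w_def[symmetric] min_def)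
qed (use assms in simp)

lemma sum_square_wave:
  assumes "0 < s" "0 \<le> j" "0 \<le> v" "v \<le> 2 * s"
  shows "(\<Sum>y\<in>{0..<2 * s * j + v}. square_wave s y) = min v (2 * s - v)"
proof -
  define m where "m = nat (2 * s * j + v)"
  have "0 \<le> 2 * s * j" using assms by simp
  then have m: "int m = 2 * s * j + v" using assms by (simp add: m_def)
  have "int m mod (2 * s) = v mod (2 * s)" by (simp add: m)
  also have "\<dots> = (if v = 2 * s then 0 else v)" using assms by simp
  finally show ?thesis using sum_square_wave_nat[OF assms(1), of m] assms by (auto simp: m)
qed

text \<open>All \<open>j\<close> with \<open>M * j\<close> in the window \<open>{c..<N + c}\<close>
  lie in \<open>{a..<a + k}\<close>; passing \<open>a\<close> explicitly keeps division out of the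
  bound.\<close>

lemma card_multiples_le:
  fixes M :: int
  assumes "0 < M" "M * (a - 1) < c" "N + c \<le> M * (a + k)" "0 \<le> k"
  shows "int (card {y \<in> {0..<N}. M dvd y + c}) \<le> k"
proof -
  have "{y \<in> {0..<N}. M dvd y + c} \<subseteq> (\<lambda>j. M * j - c) ` {a..<a + k}"
  proof
    fix y assume "y \<in> {y \<in> {0..<N}. M dvd y + c}"
    then obtain j where j: "y + c = M * j" "0 \<le> y" "y < N" by (auto elim: dvdE)
    have "M * (a - 1) < M * j" "M * j < M * (a + k)" using j assms by linarith+
    then have "a - 1 < j" "j < a + k" using assms(1) by (simp_all add: mult_less_cancel_left_pos)
    then show "y \<in> (\<lambda>j. M * j - c) ` {a..<a + k}" using j(1) by (intro image_eqI[of _ _ j]) auto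
  qed
  then have "card {y \<in> {0..<N}. M dvd y + c} \<le> card {a..<a + k}"
    by (rule surj_card_le[rotated]) simp
  then show ?thesis using assms(4) by simp
qed

section \<open>Bounds from wave weights\<close>

context file_flow begin

lemma sum_cap_le:
  assumes "\<And>y. 0 \<le> f y \<and> f y \<le> c" "\<And>y. n \<le> y + d \<Longrightarrow> f y = 0" "0 \<le> c"
    and "\<And>y. g y \<le> 2 * of_bool (P y)" and "0 \<le> d" and "int (card {y \<in> {0..<n - d}. P y}) \<le> k"
  shows "(\<Sum>y\<in>{0..<n}. f y * g y) \<le> 2 * c * k"
proof -
  have "(\<Sum>y\<in>{0..<n}. f y * g y) \<le> (\<Sum>y\<in>{0..<n}. 2 * c * of_bool (y < n - d \<and> P y))"
  proof (rule sum_mono)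
    fix y
    have "f y * g y \<le> f y * (2 * of_bool (P y))" using assms by (intro mult_left_mono) auto
    also have "\<dots> \<le> 2 * c * of_bool (y < n - d \<and> P y)" using assms(1,2)[of y] by auto
    finally show "f y * g y \<le> 2 * c * of_bool (y < n - d \<and> P y)" .
  qed
  also have "\<dots> = 2 * c * (\<Sum>y\<in>{0..<n}. of_bool (y < n - d \<and> P y))"
    by (simp add: sum_distrib_left)
  also have "(\<Sum>y\<in>{0..<n}. of_bool (y < n - d \<and> P y)) = int (card {y \<in> {0..<n - d}. P y})"
  proof -
    have "{0..<n} \<inter> {y. y < n - d \<and> P y} = {y \<in> {0..<n - d}. P y}" using assms(5) by auto
    then show ?thesis by simp
  qed
  also have "2 * c * \<dots> \<le> 2 * c * k" using assms(3,6) by (intro mult_left_mono) auto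
  finally show ?thesis .
qed

lemma sum_shift: "(\<Sum>y\<in>{0..<n}. f (y + c)) = (\<Sum>y\<in>{c..<n + c}. f y)" for f :: "int \<Rightarrow> int"
  by (rule sum.reindex_bij_witness[where i = "\<lambda>y. y - c" and j = "\<lambda>y. y + c"]) auto

text \<open>The phase \<open>c\<close> is free, to make the weight large while few rising jumps fall
  where \<open>q\<close> can be nonzero; \<open>k\<close> bounds the number of these jumps.\<close>

lemma long_wave_bound:
  assumes "2 * (r + 1) * (a - 1) < c" "n - r + c \<le> 2 * (r + 1) * (a + k)" "0 \<le> k"
  shows "(2 * r + 1) * (\<Sum>y\<in>{c..<n + c}. square_wave (r + 1) y) \<le> 2 * r * k"
proof -
  let ?l = "\<lambda>y. square_wave (r + 1) (y + c)"
  have "?l (y + (r + 1)) = - ?l y" for y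
    using square_wave_plus_period[of "r + 1" "y + c"] r_pos by (simp add: algebra_simps)
  then have "2 * (2 * r + 1) * (\<Sum>y\<in>{0..<n}. ?l y) = (\<Sum>y\<in>{0..<n}. q y * (?l y + ?l (y + r)))"
    using weighted_balance[of ?l] by simp
  also have "\<dots> \<le> 2 * (2 * r) * k"
  proof (rule sum_cap_le[where P = "\<lambda>y. 2 * (r + 1) dvd y + c"])
    show "?l y + ?l (y + r) \<le> 2 * of_bool (2 * (r + 1) dvd y + c)" for y
      using square_wave_overlap(1)[OF r_pos, of "y + c"] by (simp add: algebra_simps)
    show "int (card {y \<in> {0..<n - r}. 2 * (r + 1) dvd y + c}) \<le> k"
      using assms r_pos by (intro card_multiples_le[where a = a]) auto
  qed (use q_nonneg q_le q_outside r_pos in auto)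
  finally show ?thesis unfolding sum_shift by linarith
qed

lemma short_wave_bound:
  assumes "2 * r * (a - 1) < c + (r + 1)" "n + c \<le> 2 * r * (a + k)" "0 \<le> k"
  shows "(2 * r + 1) * (\<Sum>y\<in>{c..<n + c}. square_wave r y) \<le> 2 * (r + 1) * k"
proof -
  let ?l = "\<lambda>y. square_wave r (y + c)"
  have "?l (y + r) = - ?l y" for y
    using square_wave_plus_period[of r "y + c"] r_pos by (simp add: algebra_simps)
  then have "2 * (2 * r + 1) * (\<Sum>y\<in>{0..<n}. ?l y) = (\<Sum>y\<in>{0..<n}. p y * (?l y + ?l (y + (r + 1))))"
    using weighted_balance[of ?l] by simp
  also have "\<dots> \<le> 2 * (2 * (r + 1)) * k"
  proof (rule sum_cap_le[where P = "\<lambda>y. 2 * r dvd y + (c + (r + 1))"])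
    show "?l y + ?l (y + (r + 1)) \<le> 2 * of_bool (2 * r dvd y + (c + (r + 1)))" for y
      using square_wave_overlap(2)[OF r_pos, of "y + c"] by (simp add: algebra_simps)
    show "int (card {y \<in> {0..<n - (r + 1)}. 2 * r dvd y + (c + (r + 1))}) \<le> k"
      using assms r_pos by (intro card_multiples_le[where a = a]) auto
  qed (use p_nonneg p_le p_outside r_pos in auto)
  finally show ?thesis unfolding sum_shift by linarith
qed


lemma sum_square_wave_shifts:
  assumes "0 < s" "1 < n"
  shows "(\<Sum>y\<in>{-1..<n + - 1}. square_wave s y) = (\<Sum>y\<in>{0..<n - 1}. square_wave s y) - 1"
    and "(\<Sum>y\<in>{1..<n + 1}. square_wave s y) = (\<Sum>y\<in>{0..<n + 1}. square_wave s y) - 1"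
proof -
  have "{-1..<n + - 1} = insert (- 1) {0..<n - 1}" using assms by auto
  moreover have "square_wave s (- 1) = - 1" using assms(1) by (simp add: square_wave_def zmod_minus1)
  ultimately show "(\<Sum>y\<in>{-1..<n + - 1}. square_wave s y) = (\<Sum>y\<in>{0..<n - 1}. square_wave s y) - 1"
    by simp
  have "{0..<n + 1} = insert 0 {1..<n + 1}" using assms by auto
  then show "(\<Sum>y\<in>{1..<n + 1}. square_wave s y) = (\<Sum>y\<in>{0..<n + 1}. square_wave s y) - 1"
    using assms(1) by (simp add: square_wave_def)
qed

text \<open>The board is \<open>c = 2 * k - t\<close> files short of \<open>k\<close> periods of
  length \<open>2 * (r + 1)\<close>. The wave has weight \<open>c \<ge> k\<close>, yet at most
  \<open>k\<close> jumps count, so \<open>(2 * r + 1) * c\<close> would be at most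
  \<open>2 * r * k\<close>.\<close>

lemma no_flow_lower_half:
  assumes n: "n = 2 * k * r + t" and "1 \<le> k" "0 \<le> t" "t \<le> k" "2 * k - t \<le> r"
  shows False
proof -
  define c where "c = 2 * k - t"
  have n1: "n - 1 = 2 * (r + 1) * (k - 1) + (2 * (r + 1) - c - 1)" by (simp add: n c_def algebra_simps)
  have rk: "r \<le> k * r" using mult_right_mono[of 1 k r] assms(2) r_pos by simp
  have n2: "1 < n" using rk assms r_pos n by linarith
  have "(\<Sum>y\<in>{0..<n - 1}. square_wave (r + 1) y) = c + 1"
    unfolding n1 by (subst sum_square_wave) (use assms r_pos c_def in auto)
  then have "(\<Sum>y\<in>{-1..<n + - 1}. square_wave (r + 1) y) = c"
    using sum_square_wave_shifts(1)[of "r + 1"] r_pos n2 by simp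
  moreover have "(2 * r + 1) * (\<Sum>y\<in>{-1..<n + - 1}. square_wave (r + 1) y) \<le> 2 * r * k"
    by (rule long_wave_bound[where a = 0]) (use assms r_pos in \<open>auto simp: algebra_simps\<close>)
  ultimately have "(2 * r + 1) * c \<le> 2 * r * k" by simp
  moreover have "(2 * r + 1) * k \<le> (2 * r + 1) * c" using assms c_def r_pos by (intro mult_left_mono) auto
  ultimately show False using assms(2) by (simp add: algebra_simps)
qed

text \<open>The board exceeds \<open>k\<close> periods of length \<open>2 * r\<close> by
  \<open>t\<close> files, which gives weight \<open>t\<close> against at most \<open>k\<close>
  jumps. As \<open>k \<le> 2 * r\<close>, already \<open>t \<ge> k + 1\<close> is too much.\<close>

lemma no_flow_upper_half:
  assumes n: "n = 2 * k * r + t" and "1 \<le> k" "k < t" "t < r" "k \<le> 2 * r"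
  shows False
proof -
  have n1: "n + 1 = 2 * r * k + (t + 1)" by (simp add: n)
  have rk: "r \<le> k * r" using mult_right_mono[of 1 k r] assms(2) r_pos by simp
  have n2: "1 < n" using rk assms r_pos n by linarith
  have "(\<Sum>y\<in>{0..<n + 1}. square_wave r y) = t + 1"
    unfolding n1 by (subst sum_square_wave) (use assms r_pos in auto)
  then have "(\<Sum>y\<in>{1..<n + 1}. square_wave r y) = t"
    using sum_square_wave_shifts(2)[of r] r_pos n2 by simp
  moreover have "(2 * r + 1) * (\<Sum>y\<in>{1..<n + 1}. square_wave r y) \<le> 2 * (r + 1) * k"
    by (rule short_wave_bound[where a = 1]) (use assms r_pos in \<open>auto simp: algebra_simps\<close>)
  ultimately have "(2 * r + 1) * t \<le> 2 * (r + 1) * k" by simp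
  moreover have "(2 * r + 1) * (k + 1) \<le> (2 * r + 1) * t" using assms r_pos by (intro mult_left_mono) auto
  ultimately show False using assms by (simp add: algebra_simps)
qed

text \<open>The missing \<open>c\<close> files exceed a half-period, so the weight is limited by the
  peak of the tent and only an inequality remains. Phase 1 leaves out the rising jump at 0; for
  \<open>c > r + 2\<close> one more jump at the upper end is out of reach of
  \<open>q\<close>.\<close>

lemma flow_lower_overflow:
  assumes n: "n = 2 * k * r + t" and "2 \<le> k" "0 \<le> t" "r < c" "c \<le> 2 * r + 1" and c: "c = 2 * k - t"
  shows "c = r + 1 \<and> (2 * r + 1) * (r - 1) \<le> 2 * r * (k - 1) \<or>
         c = r + 2 \<and> (2 * r + 1) * r \<le> 2 * r * (k - 1) \<or>
         r + 2 < c \<and> (2 * r + 1) * (2 * r + 2 - c) \<le> 2 * r * (k - 2)"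
proof -
  have n1: "n + 1 = 2 * (r + 1) * (k - 1) + (2 * (r + 1) - c + 1)" by (simp add: n c algebra_simps)
  have rk: "r \<le> k * r" using mult_right_mono[of 1 k r] assms(2) r_pos by simp
  have n2: "1 < n" using rk assms r_pos n by linarith
  have "(\<Sum>y\<in>{0..<n + 1}. square_wave (r + 1) y) = (if c = r + 1 then r else 2 * r + 3 - c)"
    unfolding n1 by (subst sum_square_wave) (use assms r_pos in auto)
  then have g: "(\<Sum>y\<in>{1..<n + 1}. square_wave (r + 1) y) = (if c = r + 1 then r - 1 else 2 * r + 2 - c)"
    using sum_square_wave_shifts(2)[of "r + 1"] r_pos n2 by simp
  have b: "(2 * r + 1) * (\<Sum>y\<in>{1..<n + 1}. square_wave (r + 1) y) \<le> 2 * r * k'"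
    if "n - r + 1 \<le> 2 * (r + 1) * (1 + k')" "0 \<le> k'" for k'
    by (rule long_wave_bound[where a = 1]) (use r_pos that in auto)
  have "n - r + 1 \<le> 2 * (r + 1) * (1 + (k - 1))" using n1 assms by (simp add: algebra_simps)
  note b1 = b[OF this]
  show ?thesis
  proof (cases "r + 2 < c")
    case True
    then have "n - r + 1 \<le> 2 * (r + 1) * (1 + (k - 2))" using n1 assms by (simp add: algebra_simps)
    from b[OF this] g show ?thesis using True assms by simp
  next
    case False
    then have "c = r + 1 \<or> c = r + 2" using assms by auto
    then show ?thesis using b1 g assms by auto
  qed
qed

text \<open>From \<open>t = r\<close> on, the tent descends and the weight is
  \<open>2 * r - t\<close>.\<close>

lemma flow_upper_overflow:
  assumes n: "n = 2 * k * r + t" and "0 \<le> k" "r \<le> t" "t < 2 * r"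
  shows "(2 * r + 1) * (2 * r - t) \<le> 2 * (r + 1) * k"
proof -
  have n1: "n = 2 * r * k + t" by (simp add: n)
  have "(\<Sum>y\<in>{0..<n}. square_wave r y) = 2 * r - t"
    unfolding n1 by (subst sum_square_wave) (use assms r_pos in auto)
  moreover have "(2 * r + 1) * (\<Sum>y\<in>{0..<n + 0}. square_wave r y) \<le> 2 * (r + 1) * k"
    by (rule short_wave_bound[where a = 1]) (use assms r_pos in \<open>auto simp: algebra_simps\<close>)
  ultimately show ?thesis by simp
qed

end

section \<open>Arithmetic of the exceptional boards\<close>

definition sporadic :: "(int \<times> int) list" where
  "sporadic = [(4, 38), (4, 40), (4, 30), (4, 42), (5, 46), (5, 48), (5, 50), (6, 56), (6, 68), (6, 70), (6, 72),
    (7, 80), (8, 106), (8, 108), (8, 112), (9, 120), (10, 154), (12, 208)]"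

text \<open>This and \<open>lower_overflow\<close> collect what blocks and waves leave of
  \<open>n = 2 * k * r + t\<close>, in the upper and the lower half of the interval from
  \<open>2 * k * r\<close> to \<open>2 * k * (r + 1)\<close>.\<close>

definition upper_overflow :: "int \<Rightarrow> int \<Rightarrow> int \<Rightarrow> bool" where
  "upper_overflow r k t \<longleftrightarrow> k < t \<and> r \<le> t \<and> t \<le> 2 * k \<and> 2 * k \<le> r + 4 \<and>
    (2 * r + 1) * (2 * r - t) \<le> 2 * (r + 1) * k"

definition lower_overflow :: "int \<Rightarrow> int \<Rightarrow> int \<Rightarrow> bool" where
  "lower_overflow r k t \<longleftrightarrow> r < 2 * k - t \<and> (2 * k \<le> r + 4 \<or> 2 * k \<le> r + 6 \<and> t \<le> 2) \<and>
    (2 * k - t = r + 1 \<and> (2 * r + 1) * (r - 1) \<le> 2 * r * (k - 1) \<or>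
     2 * k - t = r + 2 \<and> (2 * r + 1) * r \<le> 2 * r * (k - 1) \<or>
     r + 2 < 2 * k - t \<and> (2 * r + 1) * (2 * r + 2 - (2 * k - t)) \<le> 2 * r * (k - 2))"

lemma small_overflow_sporadic:
  "\<forall>r \<in> set [4..12]. \<forall>k \<in> set (filter (\<lambda>k. r \<le> 2 * k \<and> 2 * k \<le> r + 6) [0..9]). \<forall>u \<in> set [0..9].
    upper_overflow r k (2 * u) \<or> lower_overflow r k (2 * u) \<longrightarrow> (r, 2 * k * r + 2 * u) \<in> set sporadic"
  by code_simp

lemma overflow_sporadic:
  assumes "4 \<le> r" "even t" "0 \<le> t" and o: "upper_overflow r k t \<or> lower_overflow r k t"
  shows "(r, 2 * k * r + t) \<in> set sporadic"
proof -
  \<comment> \<open>The left sides of the wave inequalities grow like \<open>2 * r * r\<close>, the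
    right sides like \<open>r * r\<close>, because \<open>2 * k \<le> r + 6\<close>. The upper case
    is decisive: it yields \<open>r * r \<le> 12 * r + 8\<close>.\<close>
  have "r \<le> 12"
  proof (rule ccontr)
    assume r: "\<not> r \<le> 12"
    then have R: "13 * r \<le> r * r" using assms(1) by (intro mult_right_mono) auto
    show False
      using o
    proof
      assume o: "upper_overflow r k t"
      then have "(2 * r + 1) * (r - 4) \<le> (2 * r + 1) * (2 * r - t)" "(r + 1) * (2 * k) \<le> (r + 1) * (r + 4)"
        using assms by (auto simp: upper_overflow_def intro!: mult_left_mono)
      with o R r show False unfolding upper_overflow_def by (simp only: algebra_simps; linarith)
    next
      assume o: "lower_overflow r k t"
      then have "r * (2 * k) \<le> r * (r + 6)" "(2 * r + 1) * (r - 4) \<le> (2 * r + 1) * (2 * r + 2 - (2 * k - t))"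
        using assms by (auto simp: lower_overflow_def intro!: mult_left_mono)
      with o R r show False unfolding lower_overflow_def by (elim disjE conjE; simp only: algebra_simps; linarith)
    qed
  qed
  obtain u where u: "t = 2 * u" using assms(2) by (elim evenE)
  have "r \<in> set [4..12]" "k \<in> set (filter (\<lambda>k. r \<le> 2 * k \<and> 2 * k \<le> r + 6) [0..9])" "u \<in> set [0..9]"
    using assms \<open>r \<le> 12\<close> u by (auto simp: upper_overflow_def lower_overflow_def)
  then show ?thesis using small_overflow_sporadic o unfolding u by blast
qed

context file_flow begin

lemma flow_sporadic:
  assumes r: "4 \<le> r" and "even n" "0 < n" and bound: "n < (if odd r then r * r + 5 * r + 2 else r * r + 6 * r + 4)"
  shows "(r, n) \<in> set sporadic"
proof -
  define k where "k = n div (2 * r)"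
  define t where "t = n mod (2 * r)"
  have n: "n = 2 * k * r + t" using div_mult_mod_eq[of n "2 * r"] by (simp add: k_def t_def mult_ac)
  have t: "0 \<le> t" "t < 2 * r" using r by (simp_all add: t_def)
  have k0: "0 \<le> k" using assms(3) r by (simp add: k_def pos_imp_zdiv_nonneg_iff)
  have tev: "even t" using assms(2) n by simp
  \<comment> \<open>Beyond \<open>r + 4\<close>, the bound on \<open>n\<close> leaves
    \<open>2 * k = r + 5\<close> with \<open>t < 2\<close> for odd \<open>r\<close> and
    \<open>2 * k = r + 6\<close> with \<open>t < 4\<close> for even \<open>r\<close>; moreover
    \<open>t\<close> is even.\<close>
  have k: "2 * k \<le> r + 4 \<or> 2 * k \<le> r + 6 \<and> t \<le> 2"
  proof (cases "2 * k \<le> r + 4")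
    case False
    then have "(r + 5) * r \<le> 2 * k * r" using r by (intro mult_right_mono) auto
    show ?thesis
    proof (cases "2 * k \<le> r + 5")
      case True
      then have "2 * k = r + 5" using False by simp
      moreover from this have "odd r" by presburger
      ultimately show ?thesis using bound n by (simp add: algebra_simps)
    next
      case False
      then have "(r + 6) * r \<le> 2 * k * r" using r by (intro mult_right_mono) auto
      then have ev: "even r" and t4: "t < 4"
        using bound n t r by (auto simp: algebra_simps split: if_splits)
      have "2 * k \<le> r + 6"
      proof (rule ccontr)
        assume "\<not> 2 * k \<le> r + 6"
        then have "(r + 7) * r \<le> 2 * k * r" using r by (intro mult_right_mono) auto
        then show False using bound n t r ev by (simp add: algebra_simps)
      qed
      moreover have "t \<le> 2" using t4 tev by presburger
      ultimately show ?thesis by simp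
    qed
  qed simp
  have "t \<le> 2 * k"
    using no_flow_block[of k] k0 n t by (fastforce simp: algebra_simps)
  then have k1: "1 \<le> k" using k0 n assms(3) t by (cases "k = 0") auto
  show ?thesis
  proof (cases "t \<le> k")
    case True
    have cr: "r < 2 * k - t"
      using no_flow_lower_half[OF n k1 t(1) True] by (rule ccontr) auto
    show ?thesis
    proof (cases "2 * k - t \<le> 2 * r + 1")
      case True
      then show ?thesis unfolding n
        using flow_lower_overflow[OF n _ t(1) cr True refl] cr k r t tev
        by (intro overflow_sporadic) (auto simp: lower_overflow_def)
    next
      case False
      \<comment> \<open>\<open>2 * r + 2 \<le> 2 * k - t\<close> and
        \<open>2 * k \<le> r + 6\<close> leave only the 9 by 40 board, which is listed.\<close>
      then have "r = 4 \<and> k = 5 \<and> t = 0" using k r t tev by presburger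
      then show ?thesis using n by (simp add: sporadic_def)
    qed
  next
    case False
    then have tk: "k < t" by simp
    have tr: "r \<le> t"
      using no_flow_upper_half[OF n k1 tk] k r by (intro leI notI) auto
    then have "2 * k \<le> r + 4" using k r by linarith
    then show ?thesis unfolding n
      using flow_upper_overflow[OF n k0 tr t(2)] r tk tr tev t \<open>t \<le> 2 * k\<close>
      by (intro overflow_sporadic) (auto simp: upper_overflow_def)
  qed
qed

end

section \<open>Dual certificates for the remaining boards\<close>

definition level :: "char \<Rightarrow> int" where
  "level c = (if c = CHR ''2'' then 2 else if c = CHR ''+'' then 1 else if c = CHR ''-'' then -1 else 0)"

text \<open>\<open>map2\<close> stops with the shorter list, so only files \<open>d\<close> apart
  within the board are paired.\<close>

definition overlap :: "nat \<Rightarrow> int list \<Rightarrow> int" where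
  "overlap d ls = sum_list (map2 (\<lambda>a b. max 0 (a + b)) ls (drop d ls))"

text \<open>A Farkas certificate: in the weighted balance each flow is at most its capacity times
  the positive part of its coefficient. A common factor 2 is cancelled.\<close>

definition certificate :: "nat \<Rightarrow> int list \<Rightarrow> bool" where
  "certificate r ls \<longleftrightarrow>
    int (r + 1) * overlap (r + 1) ls + int r * overlap r ls < int (2 * r + 1) * sum_list ls"

text \<open>
  Dual solutions, found by a minimum cut computation, of the linear program over all flows.
  The waves of period \<open>2 * r\<close> and \<open>2 * (r + 1)\<close> give nothing here, and the patterns interpolate between
  the two.
\<close>

definition sign_patterns :: "(nat \<times> string) list" where
  "sign_patterns =
    [(4, ''++++0---00++00--00++00---0++++''),
     (4, ''++++0---00++000--000++000--000++00---0++++''),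
     (5, ''+++++0----0++++0----0++++0----0++++0----0+++++''),
     (5, ''+++++0----00+++000--000++000--000+++00----0+++++''),
     (5, ''+++++0----00+++000--0000++0000--000+++00----0+++++''),
     (6, ''++++++0-----00++++00----00++++00----00++++00-----0++++++''),
     (6, ''++++++0-----00++++00----00++++00----00++++00----00++++00-----0++++++''),
     (6, ''++++++0-----00++++000---0000++0000--0000++0000---000++++00-----0++++++''),
     (6, ''++++++0-----00++++000---0000++00000--00000++0000---000++++00-----0++++++''),
     (7, ''+++++++0------00+++++000----000++++000----000++++000----000+++++00------0+++++++''),
     (8, ''++++++++0-------00++++++00------00++++++00------00++++++00------00++++++00------00++++++00-------0++++++++''),
     (8, ''++++++++0-------00++++++000-----0000++++0000----0000++++0000----0000++++0000-----000++++++00-------0++++++++''),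
     (8, ''++++++++0-------00++++++000-----0000++++00000----00000++++00000----00000++++0000-----000++++++00-------0++++++++''),
     (9, ''+++++++++0--------00+++++++000------000++++++000------000++++++000------000++++++000------000+++++++00--------0+++++++++''),
     (10, ''++++++++++0---------00++++++++000-------0000++++++0000------0000++++++0000------0000++++++0000------0000++++++0000-------000++++++++00---------0++++++++++''),
     (12, ''++++++++++++0-----------00++++++++++000---------0000++++++++0000--------0000++++++++0000--------0000++++++++0000--------0000++++++++0000--------0000++++++++0000---------000++++++++++00-----------0++++++++++++'')]"

lemma certificate_sign_patterns: "list_all (\<lambda>(r, s). certificate r (map level s)) sign_patterns"
  unfolding sign_patterns_def by code_simp

text \<open>The length of a pattern is its number of files. The two boards in front are left to the
  certificates with vertex sets.\<close>

lemma sporadic_eq: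
  "sporadic = (4, 38) # (4, 40) # map (\<lambda>(r, s). (int r, int (length s))) sign_patterns"
  unfolding sporadic_def sign_patterns_def by code_simp

lemma sum_list_map2_drop:
  assumes "length xs = length ys"
  shows "sum_list (map2 h xs (drop d ys)) = (\<Sum>i<length ys - d. h (xs ! i) (ys ! (i + d)))"
  unfolding sum_list_sum_nth atLeast0LessThan
  by (rule sum.cong) (use assms in \<open>auto simp: add.commute\<close>)

context file_flow begin

lemma no_flow_certificate:
  assumes "r = int r'" "n = int (length ls)" "certificate r' ls"
  shows False
proof -
  let ?l = "\<lambda>y. ls ! nat y"
  have bound: "(\<Sum>y\<in>{0..<n}. f y * (?l y + ?l (y + int d))) \<le> c * overlap d ls"
    if f: "\<And>y. 0 \<le> f y \<and> f y \<le> c" "\<And>y. n \<le> y + int d \<Longrightarrow> f y = 0" for f d c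
  proof -
    have c: "0 \<le> c" using f(1)[of 0] by linarith
    \<comment> \<open>Where \<open>y + int d\<close> leaves the board, \<open>?l\<close> is an
      unspecified list entry, but \<open>f\<close> vanishes.\<close>
    have "(\<Sum>y\<in>{0..<n}. f y * (?l y + ?l (y + int d))) = (\<Sum>y\<in>{0..<n - int d}. f y * (?l y + ?l (y + int d)))"
      by (rule sum.mono_neutral_right) (auto simp: f(2))
    also have "\<dots> \<le> (\<Sum>y\<in>{0..<n - int d}. c * max 0 (?l y + ?l (y + int d)))"
    proof (rule sum_mono)
      fix y
      have "f y * (?l y + ?l (y + int d)) \<le> f y * max 0 (?l y + ?l (y + int d))"
        using f(1)[of y] by (intro mult_left_mono) auto
      also have "\<dots> \<le> c * max 0 (?l y + ?l (y + int d))"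
        using f(1)[of y] by (intro mult_right_mono) auto
      finally show "f y * (?l y + ?l (y + int d)) \<le> c * max 0 (?l y + ?l (y + int d))" .
    qed
    also have "\<dots> = c * (\<Sum>y\<in>{0..<n - int d}. max 0 (?l y + ?l (y + int d)))"
      by (rule sum_distrib_left[symmetric])
    also have "(\<Sum>y\<in>{0..<n - int d}. max 0 (?l y + ?l (y + int d))) = overlap d ls"
      unfolding overlap_def sum_list_map2_drop[OF refl]
      by (rule sum.reindex_bij_witness[where i = int and j = nat]) (use assms(2) in \<open>auto simp: nat_add_distrib\<close>)
    finally show ?thesis .
  qed
  have "(\<Sum>y\<in>{0..<n}. ?l y) = sum_list ls"
    unfolding sum_list_sum_nth atLeast0LessThan
    by (rule sum.reindex_bij_witness[where i = int and j = nat]) (use assms(2) in auto)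
  then have "2 * (2 * r + 1) * sum_list ls =
      (\<Sum>y\<in>{0..<n}. p y * (?l y + ?l (y + (r + 1)))) + (\<Sum>y\<in>{0..<n}. q y * (?l y + ?l (y + r)))"
    using weighted_balance[of ?l] by simp
  also have "\<dots> \<le> 2 * (r + 1) * overlap (r' + 1) ls + 2 * r * overlap r' ls"
    using bound[of p "2 * (r + 1)" "r' + 1"] bound[of q "2 * r" r'] p_nonneg p_le q_nonneg q_le
      p_outside q_outside assms(1) by (intro add_mono) (auto simp: add.commute)
  finally show False
    using assms(1,3) by (simp add: certificate_def algebra_simps)
qed

end

section \<open>The flow of a leaper circuit\<close>

context leaper_cycle begin

definition crossings :: "int \<Rightarrow> int \<Rightarrow> int" where
  "crossings d y = (\<Sum>(u, w)\<in>E. of_bool (snd u = y \<and> snd w = y + d))"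


text \<open>On \<open>2 * r + 1\<close> ranks a step of width \<open>2 * r + 1 - b\<close> has
  \<open>b\<close> positions, and at each the edge can lean either way. The capacities are the cases
  \<open>b = r + 1\<close> and \<open>b = r\<close>.\<close>

lemma crossings_le:
  assumes "0 \<le> b" and b: "\<And>u w. (u, w) \<in> E \<Longrightarrow> snd w = snd u + d \<Longrightarrow> \<bar>fst w - fst u\<bar> = 2 * int r + 1 - b"
  shows "crossings d y \<le> 2 * b"
proof -
  let ?a = "2 * int r + 1 - b"
  let ?f = "\<lambda>x. ((x, y), (x + ?a, y + d))" and ?g = "\<lambda>x. ((x + ?a, y), (x, y + d))"
  let ?E = "E \<inter> {(u, w). snd u = y \<and> snd w = y + d}"
  have "?E \<subseteq> ?f ` {0..<b} \<union> ?g ` {0..<b}"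
  proof
    fix e assume e: "e \<in> ?E"
    then obtain x x' where eq: "e = ((x, y), (x', y + d))" by (cases e) auto
    then have "\<bar>x' - x\<bar> = ?a" "(x, y) \<in> board r n" "(x', y + d) \<in> board r n"
      using e b[of "(x, y)" "(x', y + d)"] edgeD[of x y x' "y + d"] by auto
    then have "x' = x + ?a \<and> x \<in> {0..<b} \<or> x = x' + ?a \<and> x' \<in> {0..<b}"
      by (auto simp: board_def)
    then show "e \<in> ?f ` {0..<b} \<union> ?g ` {0..<b}" unfolding eq by blast
  qed
  then have "card ?E \<le> card (?f ` {0..<b} \<union> ?g ` {0..<b})"
    by (rule card_mono[rotated]) simp
  also have "\<dots> \<le> card (?f ` {0..<b}) + card (?g ` {0..<b})" by (rule card_Un_le)
  also have "\<dots> \<le> nat b + nat b"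
    using card_image_le[of "{0..<b}" ?f] card_image_le[of "{0..<b}" ?g] by simp
  finally have "int (card ?E) \<le> 2 * b" using assms(1) by simp
  moreover have "crossings d y = int (card ?E)"
    using finite_E by (simp add: crossings_def case_prod_unfold)
  ultimately show ?thesis by simp
qed

lemma crossings_nonneg: "0 \<le> crossings d y"
  by (auto simp: crossings_def intro!: sum_nonneg)

lemma crossings_outside: "0 < d \<Longrightarrow> y < 0 \<or> int n \<le> y + d \<Longrightarrow> crossings d y = 0"
  unfolding crossings_def by (rule sum.neutral) (auto dest!: edgeD simp: board_def)

lemma file_flow_crossings: "file_flow (int r) (int n) (crossings (int r + 1)) (crossings (int r))"
proof
  show "crossings (int r + 1) y \<le> 2 * (int r + 1)" for y
    by (rule crossings_le) (auto dest!: edgeD)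
  show "crossings (int r) y \<le> 2 * int r" for y
    by (rule crossings_le) (auto dest!: edgeD)
  fix y :: int assume y: "0 \<le> y" "y < int n"
  \<comment> \<open>Every edge climbs \<open>r + 1\<close> or \<open>r\<close> files, so the four
    terms count each edge end in file \<open>y\<close> once.\<close>
  have "crossings (int r + 1) y + crossings (int r + 1) (y - (int r + 1)) +
      (crossings (int r) y + crossings (int r) (y - int r)) =
      (\<Sum>(u, w)\<in>E. of_bool (snd u = y) + of_bool (snd w = y))"
    unfolding crossings_def sum.distrib[symmetric]
    by (rule sum.cong) (auto dest!: edgeD)
  also have "\<dots> = 2 * (\<Sum>v\<in>board r n. of_bool (snd v = y))" by (rule weight)
  also have "(\<Sum>v\<in>board r n. of_bool (snd v = y)) = int (card (board r n \<inter> {v. snd v = y}))"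
    by (simp add: board_def)
  also have "board r n \<inter> {v. snd v = y} = {0..2 * int r} \<times> {y}"
    using y by (auto simp: board_def)
  finally show "crossings (int r + 1) y + crossings (int r + 1) (y - (int r + 1)) +
      (crossings (int r) y + crossings (int r) (y - int r)) = 2 * (2 * int r + 1)"
    by simp
qed (use r_pos in \<open>auto simp: crossings_nonneg crossings_outside\<close>)

end

section \<open>Certificates with subtour inequalities\<close>

definition column_pairs :: "nat \<Rightarrow> (nat \<times> nat \<times> nat) list" where
  "column_pairs r =
    concat (map (\<lambda>x. [(x, x + r, r + 1), (x + r, x, r + 1)]) [0..<r + 1]) @
    concat (map (\<lambda>x. [(x, x + (r + 1), r), (x + (r + 1), x, r)]) [0..<r])"

lemma set_column_pairs:
  "(x, x', d) \<in> set (column_pairs r) \<longleftrightarrow>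
    d = r + 1 \<and> (x' = x + r \<and> x \<le> r \<or> x = x' + r \<and> x' \<le> r) \<or>
    d = r \<and> (x' = x + (r + 1) \<and> x < r \<or> x = x' + (r + 1) \<and> x' < r)"
  by (auto simp: column_pairs_def)

text \<open>A vertex is encoded by its weight and its memberships in the vertex sets \<open>Cs\<close>.\<close>

definition excess :: "int \<times> bool list \<Rightarrow> int \<times> bool list \<Rightarrow> int" where
  "excess = (\<lambda>(a, bs) (a', bs'). max 0 (a + a' - sum_list (map2 (\<lambda>b b'. of_bool (b \<and> b')) bs bs')))"

definition labelled_column :: "(int \<times> int) list list \<Rightarrow> int list \<Rightarrow> int \<Rightarrow> (int \<times> bool list) list" where
  "labelled_column Cs ls x =
    map2 (\<lambda>a y. (a, map (\<lambda>C. (x, int y) \<in> set C) Cs)) ls [0..<length ls]"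

text \<open>The weights are dual variables of the degree conditions, every set in \<open>Cs\<close>
  enters with its subtour inequality and multiplier 1, and each possible edge is used at most once.
  As \<open>length C\<close> bounds the cardinality, a repeated entry could only make the test
  harder to pass.\<close>

definition cut_certificate :: "nat \<Rightarrow> nat \<Rightarrow> int list list \<Rightarrow> (int \<times> int) list list \<Rightarrow> bool" where
  "cut_certificate r n ls Cs \<longleftrightarrow>
    length ls = 2 * r + 1 \<and> list_all (\<lambda>l. length l = n) ls \<and>
    list_all (\<lambda>C. C \<noteq> [] \<and> length C < (2 * r + 1) * n \<and>
      list_all (\<lambda>(x, y). 0 \<le> x \<and> x \<le> 2 * int r \<and> 0 \<le> y \<and> y < int n) C) Cs \<and>
    (let cols = map2 (\<lambda>l x. labelled_column Cs l (int x)) ls [0..<2 * r + 1] in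
     sum_list (map (\<lambda>(x, x', d). sum_list (map2 excess (cols ! x) (drop d (cols ! x')))) (column_pairs r)) <
     2 * sum_list (map sum_list ls) - sum_list (map (\<lambda>C. int (length C) - 1) Cs))"

lemma sum_le_sum_list:
  fixes f :: "'a \<Rightarrow> int"
  assumes "\<And>x. 0 \<le> f x"
  shows "(\<Sum>x\<in>set xs. f x) \<le> sum_list (map f xs)"
proof (induction xs)
  case (Cons a xs)
  then show ?case using assms[of a] by (cases "a \<in> set xs") (auto simp: insert_absorb)
qed simp

context leaper_cycle begin

text \<open>The circuit is compared with the list of all upward moves; since \<open>f\<close> is
  nonnegative, moves outside \<open>E\<close> only increase the right side.\<close>

lemma sum_edges_le:
  fixes f :: "int \<times> int \<Rightarrow> int \<times> int \<Rightarrow> int"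
  assumes "\<And>u w. 0 \<le> f u w"
  shows "(\<Sum>(u, w)\<in>E. f u w) \<le>
    sum_list (map (\<lambda>(x, x', d). \<Sum>y<n - d. f (int x, int y) (int x', int (y + d))) (column_pairs r))"
proof -
  let ?T = "set (column_pairs r)"
  let ?S = "SIGMA t:?T. {..<n - snd (snd t)}"
  let ?e = "\<lambda>((x, x', d), y). ((int x, int y), (int x', int (y + d)))"
  have "E \<subseteq> ?e ` ?S"
  proof clarify
    fix x y x' y' assume e: "((x, y), (x', y')) \<in> E"
    have "0 \<le> x" "0 \<le> y" "0 \<le> x'" "0 \<le> y'"
      using edgeD[OF e] by (auto simp: board_def)
    then obtain i j i' j' where eq: "x = int i" "y = int j" "x' = int i'" "y' = int j'"
      by (metis nonneg_int_cases)
    have D: "i \<le> 2 * r" "i' \<le> 2 * r" "j < n" "j' < n"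
      "j' = j + (r + 1) \<and> (i' = i + r \<or> i = i' + r) \<or> j' = j + r \<and> (i' = i + (r + 1) \<or> i = i' + (r + 1))"
      using edgeD[OF e] unfolding eq board_def by (auto simp: abs_if split: if_splits)
    then have "(i, i', j' - j) \<in> ?T" "j \<le> j'"
      by (auto simp: set_column_pairs)
    then show "((x, y), x', y') \<in> ?e ` ?S"
      unfolding eq using D(3,4) by (intro image_eqI[of _ _ "((i, i', j' - j), j)"]) auto
  qed
  then have "(\<Sum>(u, w)\<in>E. f u w) \<le> (\<Sum>(u, w)\<in>?e ` ?S. f u w)"
    by (intro sum_mono2) (auto simp: assms)
  also have "\<dots> \<le> (\<Sum>s\<in>?S. (\<lambda>(u, w). f u w) (?e s))"
    using sum_image_le[of ?S "\<lambda>(u, w). f u w" ?e] by (auto simp: assms case_prod_beta o_def)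
  also have "\<dots> = (\<Sum>(x, x', d)\<in>?T. \<Sum>y<n - d. f (int x, int y) (int x', int (y + d)))"
    by (simp add: sum.Sigma case_prod_beta)
  also have "\<dots> \<le> sum_list (map (\<lambda>(x, x', d). \<Sum>y<n - d. f (int x, int y) (int x', int (y + d))) (column_pairs r))"
    by (rule sum_le_sum_list) (auto intro!: sum_nonneg assms)
  finally show ?thesis .
qed

text \<open>Degree 2 fixes the sum of \<open>l u + l w\<close> over \<open>E\<close>. Subtracting
  the number of sets around each edge costs at most what the subtour inequalities allow, and taking
  positive parts only increases the sum.\<close>

lemma weight_cut_le:
  fixes l :: "int \<times> int \<Rightarrow> int"
  assumes "\<And>C. C \<in> set Cs \<Longrightarrow> C \<noteq> [] \<and> set C \<subseteq> board r n \<and> length C < (2 * r + 1) * n"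
  shows "2 * (\<Sum>v\<in>board r n. l v) - sum_list (map (\<lambda>C. int (length C) - 1) Cs) \<le>
    (\<Sum>(u, w)\<in>E. max 0 (l u + l w - sum_list (map (\<lambda>C. of_bool (u \<in> set C \<and> w \<in> set C)) Cs)))"
    (is "_ \<le> (\<Sum>(u, w)\<in>E. max 0 (_ - ?c u w))")
proof -
  have "(\<Sum>(u, w)\<in>E. ?c u w) \<le> sum_list (map (\<lambda>C. int (length C) - 1) Cs)"
    using assms
  proof (induction Cs)
    case (Cons C Cs)
    have "card (set C) < card (board r n)"
      using card_length[of C] Cons.prems[of C] by (simp add: card_board)
    then have "(\<Sum>(u, w)\<in>E. of_bool (u \<in> set C \<and> w \<in> set C)) \<le> int (card (set C)) - 1"
      using Cons.prems[of C] by (intro cycle_edges_inside) auto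
    also have "\<dots> \<le> int (length C) - 1" using card_length[of C] by simp
    finally show ?case
      using Cons by (simp add: case_prod_unfold sum.distrib)
  qed simp
  moreover have "2 * (\<Sum>v\<in>board r n. l v) = (\<Sum>(u, w)\<in>E. (l u + l w - ?c u w) + ?c u w)"
    by (simp add: weight)
  moreover have "\<dots> = (\<Sum>(u, w)\<in>E. l u + l w - ?c u w) + (\<Sum>(u, w)\<in>E. ?c u w)"
    unfolding sum.distrib[symmetric] by (rule sum.cong) auto
  moreover have "(\<Sum>(u, w)\<in>E. l u + l w - ?c u w) \<le> (\<Sum>(u, w)\<in>E. max 0 (l u + l w - ?c u w))"
    by (rule sum_mono) auto
  ultimately show ?thesis by linarith
qed

lemma no_cut_certificate: "\<not> cut_certificate r n ls Cs"
proof
  assume c: "cut_certificate r n ls Cs"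
  let ?cols = "map2 (\<lambda>l x. labelled_column Cs l (int x)) ls [0..<2 * r + 1]"
  let ?l = "\<lambda>(x, y). ls ! nat x ! nat y"
  let ?f = "\<lambda>u w. max 0 (?l u + ?l w - sum_list (map (\<lambda>C. of_bool (u \<in> set C \<and> w \<in> set C)) Cs))"
  have len: "length ls = 2 * r + 1" "\<And>x. x < 2 * r + 1 \<Longrightarrow> length (ls ! x) = n"
    using c by (auto simp: cut_certificate_def list_all_length)
  have col: "?cols ! x = labelled_column Cs (ls ! x) (int x)" if "x < 2 * r + 1" for x
    using that len by (simp del: upt_Suc)
  have label: "labelled_column Cs (ls ! x) (int x) ! y =
      (?l (int x, int y), map (\<lambda>C. (int x, int y) \<in> set C) Cs)"
    if "x < 2 * r + 1" "y < n" for x y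
    using that len by (simp add: labelled_column_def)
  have pair: "sum_list (map2 excess (?cols ! x) (drop d (?cols ! x'))) =
      (\<Sum>y<n - d. ?f (int x, int y) (int x', int (y + d)))"
    if "(x, x', d) \<in> set (column_pairs r)" for x x' d
  proof -
    have x: "x < 2 * r + 1" "x' < 2 * r + 1" using that by (auto simp: set_column_pairs)
    have "length (labelled_column Cs (ls ! z) (int z)) = n" if "z < 2 * r + 1" for z
      using len that by (simp add: labelled_column_def)
    then show ?thesis
      unfolding col[OF x(1)] col[OF x(2)]
      by (subst sum_list_map2_drop)
        (use x in \<open>auto intro!: sum.cong simp: label excess_def map2_map_map\<close>)
  qed
  have "2 * (\<Sum>v\<in>board r n. ?l v) - sum_list (map (\<lambda>C. int (length C) - 1) Cs) \<le> (\<Sum>(u, w)\<in>E. ?f u w)"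
    using c by (intro weight_cut_le) (fastforce simp: cut_certificate_def list_all_iff board_def)
  also have "\<dots> \<le> sum_list (map (\<lambda>(x, x', d). \<Sum>y<n - d. ?f (int x, int y) (int x', int (y + d))) (column_pairs r))"
    by (rule sum_edges_le) simp
  also have "\<dots> = sum_list (map (\<lambda>(x, x', d). sum_list (map2 excess (?cols ! x) (drop d (?cols ! x')))) (column_pairs r))"
    by (intro arg_cong[of _ _ sum_list] map_cong refl) (use pair in \<open>auto split: prod.splits\<close>)
  also have "\<dots> < 2 * sum_list (map sum_list ls) - sum_list (map (\<lambda>C. int (length C) - 1) Cs)"
    using c by (simp add: cut_certificate_def Let_def del: upt_Suc)
  also have "sum_list (map sum_list ls) = (\<Sum>v\<in>board r n. ?l v)"
  proof -
    have "sum_list (map sum_list ls) = (\<Sum>x<2 * r + 1. \<Sum>y<n. ls ! x ! y)"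
      unfolding sum_list_sum_nth atLeast0LessThan length_map len(1)
      by (rule sum.cong) (auto simp: len sum_list_sum_nth atLeast0LessThan)
    also have "\<dots> = (\<Sum>(x, y)\<in>{..<2 * r + 1} \<times> {..<n}. ls ! x ! y)"
      by (rule sum.cartesian_product)
    also have "\<dots> = (\<Sum>v\<in>board r n. ?l v)"
      by (rule sum.reindex_bij_witness[where i = "\<lambda>(x, y). (nat x, nat y)" and j = "\<lambda>(x, y). (int x, int y)"])
        (auto simp: board_def)
    finally show ?thesis .
  qed
  finally show False by simp
qed

end

text \<open>
  The weights are integral optimal potentials for the cheapest 2-factor, where the cost of an edge is the number
  of the listed vertex sets that contain both its ends.  Each of these sets carries a cycle of length 18, and
  the certificate says that every 2-factor is closed on at least one of them.
\<close>

definition mirror :: "'a list \<Rightarrow> 'a list" where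
  "mirror xs = xs @ tl (rev xs)"

lemma cut_certificate_38:
  "cut_certificate 4 38 (mirror (map (map level)
    [''+++++---+0+0+00-+0+0+0--+0+0+0---02+++'',
     ''++++00--0+0+00-00+0+00-00+0+00---++2++'',
     ''++++0-0-00+00-0-00+00-0-00+00---00++2+'',
     ''++++---0-00+-0-0-00+-0-0-0++00-0-0+++2'',
     ''++++0---00++0-0-0+000-0-0+0++-0--+0+++'']))
    [[(0, 3), (0, 4), (1, 2), (1, 5), (2, 1), (2, 6), (3, 0), (3, 7), (4, 8), (4, 9), (5, 0), (5, 7), (6, 1), (6, 6), (7, 2), (7, 5), (8, 3), (8, 4)],
     [(0, 33), (0, 34), (1, 32), (1, 35), (2, 31), (2, 36), (3, 30), (3, 37), (4, 28), (4, 29), (5, 30), (5, 37), (6, 31), (6, 36), (7, 32), (7, 35), (8, 33), (8, 34)],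
     [(0, 24), (0, 35), (1, 33), (1, 36), (2, 32), (2, 37), (3, 28), (3, 31), (4, 19), (4, 30), (5, 28), (5, 31), (6, 32), (6, 37), (7, 33), (7, 36), (8, 24), (8, 35)]]"
  by code_simp

lemma cut_certificate_40:
  "cut_certificate 4 40 (mirror (map (map level)
    [''0+0+-+-+-+0+0+-+-+-+0+-+-+-+0+-+-+-+0+0+'',
     ''+0+++-+-+-+0+-+-+-+-+-+-+-+-+0+-+-+-+0+0'',
     ''-+++-+-0-+-+-+-+-+-+-+-+-+-+-+-+-0-+-+0+'',
     ''+0+-+-0-+-+-+-+-0-+-+-+-0-+-+-+-0-0-+-+-'',
     ''0+-+-0-0-+-+-+-0-+-+-+-+-+-+-+-+-0-+-+-+'']))
    [[(0, 5), (0, 12), (1, 3), (1, 6), (2, 2), (2, 7), (3, 1), (3, 8), (4, 0), (4, 17), (5, 1), (5, 8), (6, 2), (6, 7), (7, 3), (7, 6), (8, 5), (8, 12)]]"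
  by code_simp

section \<open>The theorem\<close>

theorem theorem3:
  fixes r n :: nat
  assumes "r > 3" and "n > 0"
    and "pre_digraph.hamiltonian (with_proj (leaper_graph r (r + 1) (2 * r + 1) n))"
  shows "(odd r \<longrightarrow> n \<ge> r ^ 2 + 5 * r + 2) \<and> (even r \<longrightarrow> n \<ge> r ^ 2 + 6 * r + 4)"
proof (rule ccontr)
  assume small: "\<not> ?thesis"
  obtain E where "leaper_cycle r n E"
    using hamiltonian_imp_leaper_cycle[of r n] assms by auto
  then interpret leaper_cycle r n E .
  interpret file_flow "int r" "int n" "crossings (int r + 1)" "crossings (int r)"
    by (rule file_flow_crossings)
  have sq: "int r * int r = int (r * r)" by simp
  have "int n < (if odd (int r) then int r * int r + 5 * int r + 2 else int r * int r + 6 * int r + 4)"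
    unfolding sq using small
    by (cases "odd r"; simp add: power2_eq_square not_le del: of_nat_mult; linarith)
  then have "(int r, int n) \<in> set sporadic"
    using assms even_n by (intro flow_sporadic) auto
  then consider "r = 4" "n = 38" | "r = 4" "n = 40"
    | s where "(r, s) \<in> set sign_patterns" "n = length s"
    unfolding sporadic_eq by auto
  then show False
  proof cases
    case 1
    then show ?thesis using no_cut_certificate cut_certificate_38 by blast
  next
    case 2
    then show ?thesis using no_cut_certificate cut_certificate_40 by blast
  next
    case 3
    then have "certificate r (map level s)"
      using certificate_sign_patterns by (auto simp: list_all_iff)
    then show ?thesis using no_flow_certificate[of r "map level s"] 3 by simp
  qed
qed

end
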